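(* If there exist a $(K_1,F_1,Q_1,S_1)$ placement delivery array (PDA) and a $(K_2,F_2,Q_2,S_2)$ PDA, then there exists a $(K,F,Q,S)$ PDA with $K=K_1K_2$, $F=F_1F_2$, $Q=F_1Q_2+F_2Q_1-Q_1Q_2$, and $S=S_1S_2$.
   Context: Notation: $[n]=\{1,\dots,n\}$. Placement delivery array: let $K,F,Q,S$ be positive integers with $Q<F$. An $F\times K$ array $\mathbf{P}=[p_{j,k}]$ with entries in $[S]\cup\{*\}$ is a $(K,F,Q,S)$ PDA if: (C1) the symbol $*$ appears exactly $Q$ times in each column; (C2) each integer $s\in[S]$ occurs at least once in the array; (C3) for any two distinct pairs $(j_1,k_1),(j_2,k_2)\in[F]\times[K]$, if $p_{j_1,k_1}=p_{j_2,k_2}=s\in[S]$, then $j_1\neq j_2$, $k_1\neq k_2$ and $p_{j_1,k_2}=p_{j_2,k_1}=*$. *)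

theory Defs
  imports Main
begin

text \<open>
  An array is a function from row and column indices (both starting at 1) to entries. The entry
  \<open>None\<close> is the symbol \<open>*\<close>, and \<open>Some s\<close> is the integer \<open>s\<close>. Values of the
  function outside \<open>{1..F} \<times> {1..K}\<close> are irrelevant.
\<close>

definition is_PDA :: "nat \<Rightarrow> nat \<Rightarrow> nat \<Rightarrow> nat \<Rightarrow> (nat \<Rightarrow> nat \<Rightarrow> nat option) \<Rightarrow> bool" where
  "is_PDA K F Q S p \<longleftrightarrow>
     0 < K \<and> 0 < F \<and> 0 < Q \<and> 0 < S \<and> Q < F \<and>
     (\<forall>j\<in>{1..F}. \<forall>k\<in>{1..K}. p j k \<in> insert None (Some ` {1..S})) \<and>
     (\<forall>k\<in>{1..K}. card {j\<in>{1..F}. p j k = None} = Q) \<and>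
     (\<forall>s\<in>{1..S}. \<exists>j\<in>{1..F}. \<exists>k\<in>{1..K}. p j k = Some s) \<and>
     (\<forall>j1\<in>{1..F}. \<forall>j2\<in>{1..F}. \<forall>k1\<in>{1..K}. \<forall>k2\<in>{1..K}. \<forall>s\<in>{1..S}.
        (j1, k1) \<noteq> (j2, k2) \<and> p j1 k1 = Some s \<and> p j2 k2 = Some s \<longrightarrow>
        j1 \<noteq> j2 \<and> k1 \<noteq> k2 \<and> p j1 k2 = None \<and> p j2 k1 = None)"

end

theory Submission
  imports Defs
begin

text \<open>
  Index rows, columns and symbols of the product array by pairs. An entry is \<open>*\<close> if one of its two
  components is, and the pair of component symbols otherwise; so a column has
  \<open>(F1 - Q1) * (F2 - Q2)\<close> entries that are not \<open>*\<close>. Two distinct cells with the same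
  symbol differ in one of the two components, and (C3) for that component suffices.
\<close>

text \<open>The entry condition puts every symbol that occurs into \<open>{1..S}\<close>. This
  supplies the range of \<open>s\<close> that (C3) asks for, so the last fact applies directly to
  any two equal symbols of the array.\<close>

lemma is_PDA_dest:
  assumes "is_PDA K F Q S p"
  shows "0 < K" "0 < F" "0 < Q" "0 < S" "Q < F"
    and "\<And>j k s. \<lbrakk>j \<in> {1..F}; k \<in> {1..K}; p j k = Some s\<rbrakk> \<Longrightarrow> s \<in> {1..S}"
    and "\<And>k. k \<in> {1..K} \<Longrightarrow> card {j\<in>{1..F}. p j k = None} = Q"
    and "\<And>s. s \<in> {1..S} \<Longrightarrow> \<exists>j\<in>{1..F}. \<exists>k\<in>{1..K}. p j k = Some s"
    and "\<And>j j' k k' s. \<lbrakk>j \<in> {1..F}; j' \<in> {1..F}; k \<in> {1..K}; k' \<in> {1..K};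
           p j k = Some s; p j' k' = Some s; (j, k) \<noteq> (j', k')\<rbrakk> \<Longrightarrow>
           j \<noteq> j' \<and> k \<noteq> k' \<and> p j k' = None \<and> p j' k = None"
proof -
  show "0 < K" "0 < F" "0 < Q" "0 < S" "Q < F"
    using assms unfolding is_PDA_def by blast+
  show *: "s \<in> {1..S}" if "j \<in> {1..F}" "k \<in> {1..K}" "p j k = Some s" for j k s
  proof -
    have "p j k \<in> insert None (Some ` {1..S})"
      using assms that(1,2) unfolding is_PDA_def by blast
    then show ?thesis using that(3) by auto
  qed
  show "card {j\<in>{1..F}. p j k = None} = Q" if "k \<in> {1..K}" for k
    using assms that unfolding is_PDA_def by blast
  show "\<exists>j\<in>{1..F}. \<exists>k\<in>{1..K}. p j k = Some s" if "s \<in> {1..S}" for s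
    using assms that unfolding is_PDA_def by blast
  show "j \<noteq> j' \<and> k \<noteq> k' \<and> p j k' = None \<and> p j' k = None"
    if "j \<in> {1..F}" "j' \<in> {1..F}" "k \<in> {1..K}" "k' \<in> {1..K}"
      "p j k = Some s" "p j' k' = Some s" "(j, k) \<noteq> (j', k')" for j j' k k' s
    using assms that *[OF that(1,3,5)] unfolding is_PDA_def by blast
qed

lemma card_not_None_in_column:
  assumes "is_PDA K F Q S p" and "k \<in> {1..K}"
  shows "card {j\<in>{1..F}. p j k \<noteq> None} = F - Q"
proof -
  let ?A = "{j\<in>{1..F}. p j k = None}"
  have "{j\<in>{1..F}. p j k \<noteq> None} = {1..F} - ?A"
    by auto
  moreover have "card ({1..F} - ?A) = card {1..F} - card ?A"
    by (rule card_Diff_subset) auto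
  ultimately show ?thesis
    using is_PDA_dest(7)[OF assms] by (simp only: card_atLeastAtMost diff_Suc_1)
qed

text \<open>Both sets have \<open>m * n\<close> elements. Only bijectivity of the numbering matters
  for rows, columns and symbols, so no explicit formula is chosen.\<close>

lemma ex_bij_betw_interval_product:
  "\<exists>f. bij_betw f {1..m * n} ({1..m} \<times> {1..n::nat})"
  by (rule finite_same_card_bij) simp_all

theorem theorem8:
  fixes K1 F1 Q1 S1 K2 F2 Q2 S2 :: nat
  assumes "\<exists>p. is_PDA K1 F1 Q1 S1 p"
    and "\<exists>p. is_PDA K2 F2 Q2 S2 p"
  shows "\<exists>p. is_PDA (K1 * K2) (F1 * F2) (F1 * Q2 + F2 * Q1 - Q1 * Q2) (S1 * S2) p"
proof -
  obtain p1 p2 where p1: "is_PDA K1 F1 Q1 S1 p1" and p2: "is_PDA K2 F2 Q2 S2 p2"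
    using assms by blast
  note d1 = is_PDA_dest[OF p1] and d2 = is_PDA_dest[OF p2]
  obtain f where f: "bij_betw f {1..F1 * F2} ({1..F1} \<times> {1..F2})"
    using ex_bij_betw_interval_product by blast
  obtain g where g: "bij_betw g {1..K1 * K2} ({1..K1} \<times> {1..K2})"
    using ex_bij_betw_interval_product by blast
  obtain h where h: "bij_betw h {1..S1 * S2} ({1..S1} \<times> {1..S2})"
    using ex_bij_betw_interval_product by blast
  \<comment> \<open>Rows and columns of the product are decoded into pairs by \<open>f\<close> and
    \<open>g\<close>, but a pair of symbols has to be encoded as a number, hence the inverse of
    \<open>h\<close>.\<close>
  define e where "e = the_inv_into {1..S1 * S2} h"
  have e: "bij_betw e ({1..S1} \<times> {1..S2}) {1..S1 * S2}"
    unfolding e_def by (rule bij_betw_the_inv_into[OF h])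
  define p where "p j k =
    (case (p1 (fst (f j)) (fst (g k)), p2 (snd (f j)) (snd (g k))) of
      (Some a, Some b) \<Rightarrow> Some (e (a, b)) | _ \<Rightarrow> None)" for j k
  have p_None: "p j k = None \<longleftrightarrow>
      p1 (fst (f j)) (fst (g k)) = None \<or> p2 (snd (f j)) (snd (g k)) = None" for j k
    by (auto simp: p_def split: option.splits)
  have p_Some: "\<exists>a b. p1 (fst (f j)) (fst (g k)) = Some a \<and>
      p2 (snd (f j)) (snd (g k)) = Some b \<and> s = e (a, b)" if "p j k = Some s" for j k s
    using that by (auto simp: p_def split: option.splits)
  have f_mem: "fst (f j) \<in> {1..F1}" "snd (f j) \<in> {1..F2}" if "j \<in> {1..F1 * F2}" for j
    using bij_betwE[OF f] that by (metis mem_Times_iff)+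
  have g_mem: "fst (g k) \<in> {1..K1}" "snd (g k) \<in> {1..K2}" if "k \<in> {1..K1 * K2}" for k
    using bij_betwE[OF g] that by (metis mem_Times_iff)+
  define Q where "Q = F1 * Q2 + F2 * Q1 - Q1 * Q2"
  have Q: "F1 * F2 - (F1 - Q1) * (F2 - Q2) = Q" "0 < Q" "Q < F1 * F2"
  proof -
    \<comment> \<open>Subtraction on \<open>nat\<close> truncates. With the positive differences
      \<open>a\<close> and \<open>b\<close>, \<open>Q\<close> becomes the sum
      \<open>Q1 * Q2 + a * Q2 + b * Q1\<close>, and \<open>F1 * F2\<close> exceeds it by exactly
      \<open>a * b\<close>.\<close>
    obtain a b where ab: "F1 = Q1 + a" "F2 = Q2 + b" "0 < a" "0 < b"
      using d1(5) d2(5) by (metis less_imp_add_positive)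
    have Q_eq: "Q = Q1 * Q2 + a * Q2 + b * Q1"
      unfolding Q_def ab by (simp add: algebra_simps)
    show "F1 * F2 - (F1 - Q1) * (F2 - Q2) = Q"
      unfolding Q_eq ab(1,2) by (simp add: algebra_simps)
    show "0 < Q" using d1(3) d2(3) by (simp add: Q_eq)
    show "Q < F1 * F2" using ab(3,4) unfolding Q_eq ab(1,2) by (simp add: algebra_simps)
  qed
  have entries: "p j k \<in> insert None (Some ` {1..S1 * S2})"
    if "j \<in> {1..F1 * F2}" "k \<in> {1..K1 * K2}" for j k
  proof (cases "p j k")
    case (Some s)
    then obtain a b where "p1 (fst (f j)) (fst (g k)) = Some a"
      "p2 (snd (f j)) (snd (g k)) = Some b" "s = e (a, b)"
      using p_Some by blast
    then have "s \<in> {1..S1 * S2}"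
      using d1(6)[OF f_mem(1) g_mem(1)] d2(6)[OF f_mem(2) g_mem(2)] that bij_betwE[OF e] by blast
    then show ?thesis using Some by blast
  qed simp
  have column: "card {j\<in>{1..F1 * F2}. p j k = None} = Q" if k: "k \<in> {1..K1 * K2}" for k
  proof -
    let ?A = "{j\<in>{1..F1}. p1 j (fst (g k)) \<noteq> None}"
    let ?B = "{j\<in>{1..F2}. p2 j (snd (g k)) \<noteq> None}"
    let ?N = "{j\<in>{1..F1 * F2}. p j k \<noteq> None}"
    \<comment> \<open>The rows without \<open>*\<close> form a product set, whereas the rows with
      \<open>*\<close> form a union of two overlapping sets. So the former are counted, and the
      stars are obtained as the complement.\<close>
    have "f ` ?N = ?A \<times> ?B"
    proof (intro equalityI subsetI)
      fix x assume x: "x \<in> ?A \<times> ?B"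
      then have "x \<in> f ` {1..F1 * F2}"
        unfolding bij_betw_imp_surj_on[OF f] by blast
      then obtain j where j: "x = f j" "j \<in> {1..F1 * F2}" by blast
      then have "j \<in> ?N" using x by (simp add: p_None mem_Times_iff)
      then show "x \<in> f ` ?N" using j(1) by blast
    next
      fix x assume "x \<in> f ` ?N"
      then show "x \<in> ?A \<times> ?B" using f_mem p_None by (auto simp add: mem_Times_iff simp del: not_None_eq)
    qed
    moreover have "inj_on f ?N"
      using bij_betw_imp_inj_on[OF f] by (rule inj_on_subset) blast
    ultimately have "card ?N = card (?A \<times> ?B)"
      using card_image[of f ?N] by (simp only:)
    then have N: "card ?N = (F1 - Q1) * (F2 - Q2)"
      by (simp only: card_cartesian_product card_not_None_in_column[OF p1 g_mem(1)[OF k]]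
          card_not_None_in_column[OF p2 g_mem(2)[OF k]])
    have "{j\<in>{1..F1 * F2}. p j k = None} = {1..F1 * F2} - ?N"
      by auto
    moreover have "card ({1..F1 * F2} - ?N) = card {1..F1 * F2} - card ?N"
      by (rule card_Diff_subset) auto
    ultimately show ?thesis
      using N Q(1) by (simp only: card_atLeastAtMost diff_Suc_1)
  qed
  have symbols: "\<exists>j\<in>{1..F1 * F2}. \<exists>k\<in>{1..K1 * K2}. p j k = Some s" if "s \<in> {1..S1 * S2}" for s
  proof -
    have "s \<in> e ` ({1..S1} \<times> {1..S2})"
      using that unfolding bij_betw_imp_surj_on[OF e] .
    then obtain a b where ab: "a \<in> {1..S1}" "b \<in> {1..S2}" "s = e (a, b)"
      by blast
    \<comment> \<open>A cell of each array holding its component of the decoded symbol is enough: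
      surjectivity of \<open>f\<close> and \<open>g\<close> turns the two cells into one cell of the
      product.\<close>
    obtain j1 k1 where 1: "j1 \<in> {1..F1}" "k1 \<in> {1..K1}" "p1 j1 k1 = Some a"
      using d1(8)[OF ab(1)] by blast
    obtain j2 k2 where 2: "j2 \<in> {1..F2}" "k2 \<in> {1..K2}" "p2 j2 k2 = Some b"
      using d2(8)[OF ab(2)] by blast
    have "(j1, j2) \<in> f ` {1..F1 * F2}" "(k1, k2) \<in> g ` {1..K1 * K2}"
      unfolding bij_betw_imp_surj_on[OF f] bij_betw_imp_surj_on[OF g] using 1 2 by blast+
    then obtain j k where "j \<in> {1..F1 * F2}" "f j = (j1, j2)" "k \<in> {1..K1 * K2}" "g k = (k1, k2)"
      by (metis imageE)
    moreover from this have "p j k = Some s"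
      using 1 2 ab by (simp add: p_def)
    ultimately show ?thesis by blast
  qed
  have C3: "j \<noteq> j' \<and> k \<noteq> k' \<and> p j k' = None \<and> p j' k = None"
    if j: "j \<in> {1..F1 * F2}" "j' \<in> {1..F1 * F2}" and k: "k \<in> {1..K1 * K2}" "k' \<in> {1..K1 * K2}"
      and ne: "(j, k) \<noteq> (j', k')" and s: "p j k = Some s" "p j' k' = Some s" for j j' k k' s
  proof -
    obtain a b where ab: "p1 (fst (f j)) (fst (g k)) = Some a"
      "p2 (snd (f j)) (snd (g k)) = Some b" "s = e (a, b)"
      using p_Some[OF s(1)] by blast
    obtain a' b' where ab': "p1 (fst (f j')) (fst (g k')) = Some a'"
      "p2 (snd (f j')) (snd (g k')) = Some b'" "s = e (a', b')"
      using p_Some[OF s(2)] by blast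
    note fj = f_mem[OF j(1)] f_mem[OF j(2)] and gk = g_mem[OF k(1)] g_mem[OF k(2)]
    \<comment> \<open>\<open>e\<close> is injective only on pairs of genuine symbols, so the ranges
      come before equal codes can give equal pairs.\<close>
    have "a \<in> {1..S1}" "a' \<in> {1..S1}" "b \<in> {1..S2}" "b' \<in> {1..S2}"
      using d1(6)[OF fj(1) gk(1) ab(1)] d1(6)[OF fj(3) gk(3) ab'(1)]
        d2(6)[OF fj(2) gk(2) ab(2)] d2(6)[OF fj(4) gk(4) ab'(2)] by blast+
    then have "(a, b) = (a', b')"
      using inj_onD[OF bij_betw_imp_inj_on[OF e], of "(a, b)" "(a', b')"] ab(3) ab'(3) by simp
    then have eq: "a' = a" "b' = b" by simp_all
    have "f j \<noteq> f j' \<or> g k \<noteq> g k'"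
      using ne inj_onD[OF bij_betw_imp_inj_on[OF f] _ j] inj_onD[OF bij_betw_imp_inj_on[OF g] _ k]
      by blast
    \<comment> \<open>The cases may overlap. In either one, the cells of the other array may
      coincide, and (C3) is then silent about them.\<close>
    then consider "(fst (f j), fst (g k)) \<noteq> (fst (f j'), fst (g k'))"
      | "(snd (f j), snd (g k)) \<noteq> (snd (f j'), snd (g k'))"
      by (metis prod.inject prod_eq_iff)
    then show ?thesis
    proof cases
      case 1
      \<comment> \<open>Different first components of \<open>f j\<close> and \<open>f j'\<close>
        force different rows, and likewise for columns with \<open>g\<close>. A star of
        \<open>p1\<close> at a crossed position makes the entry of \<open>p\<close> there a star,
        whatever \<open>p2\<close> holds.\<close>
      then show ?thesis
        using d1(9)[OF fj(1,3) gk(1,3) ab(1) ab'(1)[unfolded eq]] p_None by metis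
    next
      case 2
      then show ?thesis
        using d2(9)[OF fj(2,4) gk(2,4) ab(2) ab'(2)[unfolded eq]] p_None by metis
    qed
  qed
  have "is_PDA (K1 * K2) (F1 * F2) Q (S1 * S2) p"
    unfolding is_PDA_def
  proof (intro conjI)
    show "0 < K1 * K2" "0 < F1 * F2" "0 < Q" "0 < S1 * S2" "Q < F1 * F2"
      using d1(1,2,4) d2(1,2,4) Q(2,3) by simp_all
    show "\<forall>j1\<in>{1..F1 * F2}. \<forall>j2\<in>{1..F1 * F2}. \<forall>k1\<in>{1..K1 * K2}. \<forall>k2\<in>{1..K1 * K2}. \<forall>s\<in>{1..S1 * S2}.
        (j1, k1) \<noteq> (j2, k2) \<and> p j1 k1 = Some s \<and> p j2 k2 = Some s \<longrightarrow>
        j1 \<noteq> j2 \<and> k1 \<noteq> k2 \<and> p j1 k2 = None \<and> p j2 k1 = None"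
      by (intro ballI impI, rule C3) simp_all
  qed (intro ballI entries column symbols; assumption)+
  then show ?thesis unfolding Q_def by blast
qed

end
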